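(* Let $\mathcal{M}$ be any infinite structure. There is a proper elementary extension $\mathcal{M}^\ast$ of $\mathcal{M}$ and an automorphism $\alpha$ of $\mathcal{M}^\ast$ such that $\alpha$ and all its finite iterates $\alpha^n$ ($n\ge1$) fix each element of $M$ and move every element of $M^\ast\setminus M$. Indeed, for any cardinal $\kappa\ge\max\{|M|,|\mathcal{L}(\mathcal{M})|\}$, such an $\mathcal{M}^\ast$ can be chosen of cardinality $\kappa$.
   Context: $M$ and $M^\ast$ denote the universes of $\mathcal{M}$ and $\mathcal{M}^\ast$; $\mathcal{L}(\mathcal{M})$ is the language of $\mathcal{M}$. *)

theory Defs
  imports Main
begin

unbundle cardinal_syntax

text \<open>First-order languages with equality; constants are function symbols of arity 0.\<close>

record ('f, 'r) language =
  funs :: "'f set"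
  rels :: "'r set"
  fun_arity :: "'f \<Rightarrow> nat"
  rel_arity :: "'r \<Rightarrow> nat"

definition symbols :: "('f, 'r) language \<Rightarrow> ('f + 'r) set" where
  "symbols L = funs L <+> rels L"

datatype 'f tm = Var nat | App 'f "'f tm list"

datatype ('f, 'r) fm =
    Eq "'f tm" "'f tm"
  | Atom 'r "'f tm list"
  | Neg "('f, 'r) fm"
  | Conj "('f, 'r) fm" "('f, 'r) fm"
  | Exi nat "('f, 'r) fm"

fun wf_tm :: "('f, 'r) language \<Rightarrow> 'f tm \<Rightarrow> bool" where
  "wf_tm L (Var n) \<longleftrightarrow> True"
| "wf_tm L (App f ts) \<longleftrightarrow>
     f \<in> funs L \<and> length ts = fun_arity L f \<and> (\<forall>t\<in>set ts. wf_tm L t)"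

fun wf_fm :: "('f, 'r) language \<Rightarrow> ('f, 'r) fm \<Rightarrow> bool" where
  "wf_fm L (Eq t u) \<longleftrightarrow> wf_tm L t \<and> wf_tm L u"
| "wf_fm L (Atom R ts) \<longleftrightarrow>
     R \<in> rels L \<and> length ts = rel_arity L R \<and> (\<forall>t\<in>set ts. wf_tm L t)"
| "wf_fm L (Neg \<phi>) \<longleftrightarrow> wf_fm L \<phi>"
| "wf_fm L (Conj \<phi> \<psi>) \<longleftrightarrow> wf_fm L \<phi> \<and> wf_fm L \<psi>"
| "wf_fm L (Exi n \<phi>) \<longleftrightarrow> wf_fm L \<phi>"

text \<open>The interpretations are total functions; only their values at symbols of the language and at
  tuples of the right length over the universe carry meaning.\<close>

record ('a, 'f, 'r) struct =
  lang :: "('f, 'r) language"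
  universe :: "'a set"
  fun_interp :: "'f \<Rightarrow> 'a list \<Rightarrow> 'a"
  rel_interp :: "'r \<Rightarrow> 'a list \<Rightarrow> bool"

definition tuples :: "'a set \<Rightarrow> nat \<Rightarrow> 'a list set" where
  "tuples A n = {xs. set xs \<subseteq> A \<and> length xs = n}"

definition is_structure :: "('a, 'f, 'r) struct \<Rightarrow> bool" where
  "is_structure M \<longleftrightarrow> universe M \<noteq> {} \<and>
     (\<forall>f\<in>funs (lang M). \<forall>xs\<in>tuples (universe M) (fun_arity (lang M) f).
        fun_interp M f xs \<in> universe M)"

fun eval :: "('a, 'f, 'r) struct \<Rightarrow> (nat \<Rightarrow> 'a) \<Rightarrow> 'f tm \<Rightarrow> 'a" where
  "eval M s (Var n) = s n"
| "eval M s (App f ts) = fun_interp M f (map (eval M s) ts)"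

fun sat :: "('a, 'f, 'r) struct \<Rightarrow> (nat \<Rightarrow> 'a) \<Rightarrow> ('f, 'r) fm \<Rightarrow> bool" where
  "sat M s (Eq t u) \<longleftrightarrow> eval M s t = eval M s u"
| "sat M s (Atom R ts) \<longleftrightarrow> rel_interp M R (map (eval M s) ts)"
| "sat M s (Neg \<phi>) \<longleftrightarrow> \<not> sat M s \<phi>"
| "sat M s (Conj \<phi> \<psi>) \<longleftrightarrow> sat M s \<phi> \<and> sat M s \<psi>"
| "sat M s (Exi n \<phi>) \<longleftrightarrow> (\<exists>a\<in>universe M. sat M (s(n := a)) \<phi>)"

definition isomorphism ::
  "('a \<Rightarrow> 'b) \<Rightarrow> ('a, 'f, 'r) struct \<Rightarrow> ('b, 'f, 'r) struct \<Rightarrow> bool" where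
  "isomorphism h M N \<longleftrightarrow> lang N = lang M \<and> bij_betw h (universe M) (universe N) \<and>
     (\<forall>f\<in>funs (lang M). \<forall>xs\<in>tuples (universe M) (fun_arity (lang M) f).
        h (fun_interp M f xs) = fun_interp N f (map h xs)) \<and>
     (\<forall>R\<in>rels (lang M). \<forall>xs\<in>tuples (universe M) (rel_arity (lang M) R).
        rel_interp M R xs \<longleftrightarrow> rel_interp N R (map h xs))"

definition automorphism :: "('a \<Rightarrow> 'a) \<Rightarrow> ('a, 'f, 'r) struct \<Rightarrow> bool" where
  "automorphism h M \<longleftrightarrow> isomorphism h M M"

definition substructure :: "('a, 'f, 'r) struct \<Rightarrow> ('a, 'f, 'r) struct \<Rightarrow> bool" where
  "substructure M N \<longleftrightarrow> is_structure M \<and> is_structure N \<and>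
     lang N = lang M \<and> universe M \<subseteq> universe N \<and>
     (\<forall>f\<in>funs (lang M). \<forall>xs\<in>tuples (universe M) (fun_arity (lang M) f).
        fun_interp N f xs = fun_interp M f xs) \<and>
     (\<forall>R\<in>rels (lang M). \<forall>xs\<in>tuples (universe M) (rel_arity (lang M) R).
        rel_interp N R xs \<longleftrightarrow> rel_interp M R xs)"

definition elementary_extension :: "('a, 'f, 'r) struct \<Rightarrow> ('a, 'f, 'r) struct \<Rightarrow> bool" where
  "elementary_extension M N \<longleftrightarrow> substructure M N \<and>
     (\<forall>\<phi> s. wf_fm (lang M) \<phi> \<and> range s \<subseteq> universe M \<longrightarrow> (sat M s \<phi> \<longleftrightarrow> sat N s \<phi>))"

definition proper_elementary_extension ::
  "('a, 'f, 'r) struct \<Rightarrow> ('a, 'f, 'r) struct \<Rightarrow> bool" where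
  "proper_elementary_extension M N \<longleftrightarrow> elementary_extension M N \<and> universe M \<subset> universe N"

text \<open>A structure on a type may already exhaust that type, leaving no room for a proper
  extension. It is therefore identified with its isomorphic copy along an injection into a larger
  type.\<close>

definition copy :: "('a \<Rightarrow> 'b) \<Rightarrow> ('a, 'f, 'r) struct \<Rightarrow> ('b, 'f, 'r) struct" where
  "copy h M = \<lparr>lang = lang M, universe = h ` universe M,
     fun_interp = (\<lambda>f xs. h (fun_interp M f (map (inv_into (universe M) h) xs))),
     rel_interp = (\<lambda>R xs. rel_interp M R (map (inv_into (universe M) h) xs))\<rparr>"

lemma isomorphism_copy:
  assumes "inj_on h (universe M)"
  shows "isomorphism h M (copy h M)"
proof -
  have "map (inv_into (universe M) h \<circ> h) xs = xs" if "set xs \<subseteq> universe M" for xs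
    using that assms by (intro map_idI) (auto simp: inv_into_f_f)
  then show ?thesis
    using assms by (auto simp: isomorphism_def copy_def tuples_def bij_betw_def)
qed

end

theory Submission
  imports Defs "HOL-Library.Countable"
begin

text \<open>Iterate an ultrafilter along the integers. A function of finitely many integer-indexed
  coordinates represents an element of the iterated ultrapower, and translation of the coordinates is
  an automorphism \<open>\<alpha>\<close> fixing the constants. If a power of \<open>\<alpha>\<close> fixes an element, then some further
  power carries its coordinates beyond all the original ones and still fixes it; two independent
  copies of a function agree almost everywhere only if the function is almost everywhere constant, so
  the element lies in \<open>M\<close>. To obtain cardinality \<open>\<kappa>\<close>, only those functions are kept that are generated
  from the constants and \<open>\<kappa>\<close> independent functions of each coordinate by the functions of the
  language and Skolem functions of \<open>M\<close>, applied pointwise. This family is closed under translation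
  and satisfies the theorem of Los.\<close>

section \<open>Cardinality of finitary closures\<close>

text \<open>There is no separate base clause: initial elements arise as \<open>op g []\<close>.
  Arities are not recorded, so an operation must make sense on lists of every length; this keeps the
  counting uniform.\<close>

inductive_set closure :: "('g \<Rightarrow> 'x list \<Rightarrow> 'x) \<Rightarrow> 'g set \<Rightarrow> 'x set"
  for op :: "'g \<Rightarrow> 'x list \<Rightarrow> 'x" and G :: "'g set" where
  step: "g \<in> G \<Longrightarrow> \<forall>x \<in> set xs. x \<in> closure op G \<Longrightarrow> op g xs \<in> closure op G"

lemma card_of_Times_bound:
  assumes "Cinfinite r" "|A| \<le>o r" "|B| \<le>o r"
  shows "|A \<times> B| \<le>o r"
  using assms by (intro card_of_Times_ordLeq_infinite_Field) (auto simp: cinfinite_def)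

lemma card_of_Plus_bound:
  assumes "Cinfinite r" "|A| \<le>o r" "|B| \<le>o r"
  shows "|A <+> B| \<le>o r"
  using assms by (intro card_of_Plus_ordLeq_infinite_Field) (auto simp: cinfinite_def)

lemma card_of_image_bound:
  assumes "|A| \<le>o r" "B \<subseteq> f ` A"
  shows "|B| \<le>o r"
  using ordLeq_transitive[OF card_of_mono1[OF assms(2)] ordLeq_transitive[OF card_of_image assms(1)]] .

lemma card_of_countable_bound:
  fixes A :: "'b::countable set"
  assumes "Cinfinite r"
  shows "|A| \<le>o r"
proof -
  have "|A| \<le>o |UNIV :: nat set|"
    using card_of_ordLeq[of A "UNIV :: nat set"] inj_on_subset[OF inj_to_nat, of A] by auto
  also have "|UNIV :: nat set| \<le>o r"
    by (rule ordIso_ordLeq_trans[OF card_of_nat natLeq_ordLeq_cinfinite[OF assms]])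
  finally show ?thesis .
qed

lemma card_of_lists_bound:
  assumes r: "Cinfinite r" and "|A| \<le>o r"
  shows "|lists A| \<le>o r"
proof -
  have "|{xs \<in> lists A. length xs = n}| \<le>o r" for n
  proof (induction n)
    case 0
    have "{xs \<in> lists A. length xs = 0} \<subseteq> (\<lambda>_. []) ` (UNIV :: nat set)" by auto
    then show ?case by (rule card_of_image_bound[OF card_of_countable_bound[OF r]])
  next
    case (Suc n)
    have "{xs \<in> lists A. length xs = Suc n}
        \<subseteq> (\<lambda>(x, xs). x # xs) ` (A \<times> {xs \<in> lists A. length xs = n})"
      by (auto simp: length_Suc_conv image_def)
    then show ?case
      by (rule card_of_image_bound[OF card_of_Times_bound[OF r assms(2) Suc]])
  qed
  then have "|\<Union>n \<in> (UNIV :: nat set). {xs \<in> lists A. length xs = n}| \<le>o r"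
    by (intro UNION_Cinfinite_bound card_of_countable_bound ballI r)
  moreover have "(\<Union>n. {xs \<in> lists A. length xs = n}) = lists A" by auto
  ultimately show ?thesis by simp
qed

text \<open>The closure is a countable union of stages, each adding the results of all operations on
  lists over the previous one. Lists over a set of size at most \<open>r\<close> are again at most
  \<open>r\<close> many, so the bound survives every stage.\<close>

lemma card_of_closure_bound:
  assumes r: "Cinfinite r" and G: "|G| \<le>o r"
  shows "|closure op G| \<le>o r"
proof -
  define stage where
    "stage n = ((\<lambda>X. X \<union> (\<lambda>(g, xs). op g xs) ` (G \<times> lists X)) ^^ n) {}" for n
  have stage_Suc: "stage (Suc n) = stage n \<union> (\<lambda>(g, xs). op g xs) ` (G \<times> lists (stage n))" for n
    by (simp add: stage_def)
  have mono: "stage m \<subseteq> stage n" if "m \<le> n" for m n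
    using that by (rule lift_Suc_mono_le[rotated]) (auto simp: stage_Suc)
  have "|stage n| \<le>o r" for n
  proof (induction n)
    case 0
    show ?case using card_of_image_bound[OF card_of_countable_bound[OF r, of "{} :: nat set"]]
      by (simp add: stage_def)
  next
    case (Suc n)
    have "|(\<lambda>(g, xs). op g xs) ` (G \<times> lists (stage n))| \<le>o r"
      by (rule card_of_image_bound[OF _ order_refl])
        (intro card_of_Times_bound card_of_lists_bound r G Suc)
    then show ?case unfolding stage_Suc by (intro Un_Cinfinite_bound Suc r)
  qed
  then have bd: "|\<Union>n. stage n| \<le>o r"
    by (intro UNION_Cinfinite_bound card_of_countable_bound ballI r)
  have "x \<in> (\<Union>n. stage n)" if "x \<in> closure op G" for x
    using that
  proof induction
    case (step g xs)
    \<comment> \<open>The argument list is finite and the stages increase, so one stage contains all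
      the arguments.\<close>
    have "\<exists>n. set xs \<subseteq> stage n"
      using step(2)
    proof (induction xs)
      case (Cons x xs)
      then obtain m n where "x \<in> stage m" "set xs \<subseteq> stage n" by auto
      then have "set (x # xs) \<subseteq> stage (max m n)"
        using mono[of m "max m n"] mono[of n "max m n"] by auto
      then show ?case ..
    qed simp
    then obtain n where "set xs \<subseteq> stage n" ..
    then have "op g xs \<in> stage (Suc n)"
      using step(1) unfolding stage_Suc by force
    then show ?case by blast
  qed
  then have "closure op G \<subseteq> (\<Union>n. stage n)" by blast
  then show ?thesis by (rule ordLeq_transitive[OF card_of_mono1 bd])
qed

section \<open>Counting terms and formulas\<close>

lemma card_of_wf_tm_bound:
  fixes L :: "('f, 'r) language"
  assumes r: "Cinfinite r" and "|funs L| \<le>o r"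
  shows "|{t. wf_tm L t}| \<le>o r"
proof -
  define op :: "nat + 'f \<Rightarrow> 'f tm list \<Rightarrow> 'f tm" where
    "op g ts = (case g of Inl n \<Rightarrow> Var n | Inr f \<Rightarrow> App f ts)" for g ts
  have op_simps: "op (Inl n) ts = Var n" "op (Inr f) ts = App f ts" for n f ts
    by (simp_all add: op_def)
  note cl = closure.step[of _ "UNIV <+> funs L" _ op]
  have "wf_tm L t \<Longrightarrow> t \<in> closure op (UNIV <+> funs L)" for t
  proof (induction t)
    case (Var n)
    show ?case using cl[OF InlI, of n "[]"] by (simp add: op_simps)
  next
    case (App f ts)
    then show ?case using cl[OF InrI, of f ts] by (simp add: op_simps)
  qed
  then have "{t. wf_tm L t} \<subseteq> closure op (UNIV <+> funs L)" by blast
  moreover have "|closure op (UNIV <+> funs L)| \<le>o r"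
    using assms by (intro card_of_closure_bound card_of_Plus_bound card_of_countable_bound)
  ultimately show ?thesis by (rule ordLeq_transitive[OF card_of_mono1])
qed

lemma card_of_wf_fm_bound:
  fixes L :: "('f, 'r) language"
  assumes r: "Cinfinite r" and "|symbols L| \<le>o r"
  shows "|{\<phi>. wf_fm L \<phi>}| \<le>o r"
proof -
  have funs: "|funs L| \<le>o r" and rels: "|rels L| \<le>o r"
    using assms(2) unfolding symbols_def
    by (rule ordLeq_transitive[OF card_of_Plus1] ordLeq_transitive[OF card_of_Plus2])+
  let ?T = "{t. wf_tm L t}"
  let ?G = "(?T \<times> ?T) <+> ((rels L \<times> lists ?T) <+> (UNIV :: nat set))"
  \<comment> \<open>The number of arguments selects the connective: one for the quantifier, two for
    conjunction, any other for negation of the head, used below with three copies. The closure may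
    contain further formulas, but only an inclusion is needed for the upper bound.\<close>
  define op :: "('f tm \<times> 'f tm) + (('r \<times> 'f tm list) + nat) \<Rightarrow> ('f, 'r) fm list \<Rightarrow> ('f, 'r) fm"
    where "op g \<phi>s = (case g of Inl (t, u) \<Rightarrow> Eq t u | Inr (Inl (R, ts)) \<Rightarrow> Atom R ts
      | Inr (Inr n) \<Rightarrow> (case \<phi>s of [\<phi>] \<Rightarrow> Exi n \<phi> | [\<phi>, \<psi>] \<Rightarrow> Conj \<phi> \<psi> | _ \<Rightarrow> Neg (hd \<phi>s)))"
    for g \<phi>s
  have op_simps: "op (Inl (t, u)) \<phi>s = Eq t u" "op (Inr (Inl (R, ts))) \<phi>s = Atom R ts"
      "op (Inr (Inr n)) [\<phi>] = Exi n \<phi>" "op (Inr (Inr n)) [\<phi>, \<psi>] = Conj \<phi> \<psi>"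
      "op (Inr (Inr n)) [\<phi>, \<phi>, \<phi>] = Neg \<phi>" for t u \<phi>s R ts n \<phi> \<psi>
    by (simp_all add: op_def)
  note cl = closure.step[of _ ?G _ op]
  note cl_eq = cl[OF InlI] and cl_atom = cl[OF InrI[OF InlI]] and cl_con = cl[OF InrI[OF InrI]]
  have "wf_fm L \<phi> \<Longrightarrow> \<phi> \<in> closure op ?G" for \<phi>
  proof (induction \<phi>)
    case (Eq t u)
    then show ?case using cl_eq[of "(t, u)" "[]"] by (simp add: op_simps)
  next
    case (Atom R ts)
    then show ?case using cl_atom[of "(R, ts)" "[]"] by (simp add: op_simps in_lists_conv_set)
  next
    case (Neg \<phi>)
    then show ?case using cl_con[of 0 "[\<phi>, \<phi>, \<phi>]"] by (simp add: op_simps)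
  next
    case (Conj \<phi> \<psi>)
    then show ?case using cl_con[of 0 "[\<phi>, \<psi>]"] by (simp add: op_simps)
  next
    case (Exi n \<phi>)
    then show ?case using cl_con[of n "[\<phi>]"] by (simp add: op_simps)
  qed
  then have "{\<phi>. wf_fm L \<phi>} \<subseteq> closure op ?G" by blast
  moreover have "|closure op ?G| \<le>o r"
    using r funs rels by (intro card_of_closure_bound card_of_Plus_bound card_of_countable_bound
      card_of_Times_bound card_of_lists_bound card_of_wf_tm_bound)
  ultimately show ?thesis by (rule ordLeq_transitive[OF card_of_mono1])
qed

section \<open>Ultrafilters\<close>

definition ultrafilter :: "'e filter \<Rightarrow> bool" where
  "ultrafilter D \<longleftrightarrow> D \<noteq> bot \<and> (\<forall>P. eventually P D \<or> eventually (\<lambda>x. \<not> P x) D)"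

lemma ultrafilter_not:
  assumes "ultrafilter D"
  shows "eventually (\<lambda>x. \<not> P x) D \<longleftrightarrow> \<not> eventually P D"
proof -
  have False if "eventually (\<lambda>x. \<not> P x) D" "eventually P D"
    using eventually_conj[OF that] assms by (simp add: ultrafilter_def)
  then show ?thesis using assms by (auto simp: ultrafilter_def)
qed

lemma ultrafilter_const:
  assumes "ultrafilter D"
  shows "eventually (\<lambda>x. P) D \<longleftrightarrow> P"
  using assms by (cases P) (auto simp: ultrafilter_def)

text \<open>Finer filters are smaller in the order, so Zorn's lemma is applied to the proper filters
  below \<open>F\<close> with the order reversed, giving a minimal proper filter.\<close>

lemma ultrafilter_exists:
  assumes "F \<noteq> bot"
  obtains D where "ultrafilter D" "D \<le> F"
proof -
  let ?A = "{D. D \<noteq> bot \<and> D \<le> F}"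
  have "\<exists>m \<in> ?A. \<forall>a \<in> ?A. a \<le> m \<longrightarrow> a = m"
  proof (rule predicate_Zorn)
    show "partial_order_on ?A (relation_of (\<lambda>x y. y \<le> x) ?A)"
      by (rule partial_order_on_relation_ofI) auto
    fix C assume "C \<in> Chains (relation_of (\<lambda>x y. y \<le> x) ?A)"
    then have C: "C \<subseteq> ?A" "\<And>x y. x \<in> C \<Longrightarrow> y \<in> C \<Longrightarrow> x \<le> y \<or> y \<le> x"
      by (auto simp: Chains_def relation_of_def)
    show "\<exists>u \<in> ?A. \<forall>a \<in> C. u \<le> a"
    proof (cases "C = {}")
      case True
      then show ?thesis using assms by auto
    next
      case False
      \<comment> \<open>A chain is directed, so a predicate eventual for its infimum is already
        eventual for one member; hence the infimum is proper.\<close>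
      have "\<exists>x\<in>C. x \<le> inf F G" if "F \<in> C" "G \<in> C" for F G
        using C(2)[OF that] that by (auto simp: le_inf_iff)
      then have "eventually P (Inf C) \<longleftrightarrow> (\<exists>b\<in>C. eventually P b)" for P
        using False by (intro eventually_Inf_base)
      then have "Inf C \<noteq> bot" using C(1) by (auto simp: trivial_limit_def)
      moreover have "Inf C \<le> F" using False C(1) by (auto intro: Inf_lower2)
      ultimately show ?thesis by (auto intro: Inf_lower)
    qed
  qed
  then obtain D where D: "D \<noteq> bot" "D \<le> F" "\<And>a. a \<noteq> bot \<Longrightarrow> a \<le> F \<Longrightarrow> a \<le> D \<Longrightarrow> a = D"
    by auto
  have "eventually P D \<or> eventually (\<lambda>x. \<not> P x) D" for P
  proof (rule disjCI)
    \<comment> \<open>Adding \<open>P\<close> to \<open>D\<close> then leaves a proper filter, which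
      minimality identifies with \<open>D\<close>.\<close>
    assume "\<not> eventually (\<lambda>x. \<not> P x) D"
    then have "inf D (principal {x. P x}) \<noteq> bot"
      by (auto simp: trivial_limit_def eventually_inf_principal)
    then have "inf D (principal {x. P x}) = D"
      using D(2) by (intro D(3)) (auto intro: le_infI1)
    moreover have "eventually P (inf D (principal {x. P x}))"
      by (simp add: eventually_inf_principal)
    ultimately show "eventually P D" by simp
  qed
  then show ?thesis using D by (intro that) (auto simp: ultrafilter_def)
qed

section \<open>Iterated ultrafilters along the integers\<close>

text \<open>\<open>iterate U P a k\<close> quantifies the coordinates \<open>a, \<dots>, a + k - 1\<close> by \<open>U\<close>, the least one
  outermost.\<close>

fun iterate :: "'j filter \<Rightarrow> ((int \<Rightarrow> 'j) \<Rightarrow> bool) \<Rightarrow> int \<Rightarrow> nat \<Rightarrow> (int \<Rightarrow> 'j) \<Rightarrow> bool" where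
  "iterate U P a 0 e = P e"
| "iterate U P a (Suc k) e = (\<forall>\<^sub>F x in U. iterate U P (a + 1) k (e(a := x)))"

section \<open>Supports, translation and the calculus of finite iterations\<close>

definition depends_on :: "'i set \<Rightarrow> (('i \<Rightarrow> 'j) \<Rightarrow> 'b) \<Rightarrow> bool" where
  "depends_on S x \<longleftrightarrow> (\<forall>e e'. (\<forall>i\<in>S. e i = e' i) \<longrightarrow> x e = x e')"

definition shift :: "int \<Rightarrow> (int \<Rightarrow> 'j) \<Rightarrow> int \<Rightarrow> 'j" where
  "shift m e = (\<lambda>i. e (i + m))"

lemma depends_onD: "depends_on S x \<Longrightarrow> (\<And>i. i \<in> S \<Longrightarrow> e i = e' i) \<Longrightarrow> x e = x e'"
  by (auto simp: depends_on_def)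

lemma depends_on_mono: "depends_on S x \<Longrightarrow> S \<subseteq> T \<Longrightarrow> depends_on T x"
  by (auto simp: depends_on_def subset_iff)

text \<open>An arbitrary increasing sequence of supports is allowed because two are needed: initial
  segments of the variables, and symmetric intervals of integers.\<close>

lemma depends_on_list:
  fixes S :: "nat \<Rightarrow> 'i set"
  assumes "mono S" "\<And>x. x \<in> set xs \<Longrightarrow> \<exists>n. depends_on (S n) (f x)"
  shows "\<exists>n. depends_on (S n) (\<lambda>e. map (\<lambda>x. f x e) xs)"
  using assms(2)
proof (induction xs)
  case Nil
  show ?case by (simp add: depends_on_def)
next
  case (Cons x xs)
  obtain m where m: "depends_on (S m) (f x)" using Cons.prems[of x] by auto
  obtain n where n: "depends_on (S n) (\<lambda>e. map (\<lambda>x. f x e) xs)"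
    using Cons.IH Cons.prems by auto
  have "depends_on (S (max m n)) (f x)" "depends_on (S (max m n)) (\<lambda>e. map (\<lambda>x. f x e) xs)"
    by (rule depends_on_mono[OF m] depends_on_mono[OF n], rule monoD[OF assms(1)], simp)+
  then have "depends_on (S (max m n)) (\<lambda>e. map (\<lambda>x. f x e) (x # xs))"
    unfolding depends_on_def list.map by blast
  then show ?case ..
qed

lemma depends_on_compose: "depends_on S x \<Longrightarrow> depends_on S (\<lambda>e. g (x e))"
  unfolding depends_on_def by metis

lemma depends_on_shift: "depends_on S x \<Longrightarrow> depends_on ((+) m ` S) (\<lambda>e. x (shift m e))"
  unfolding depends_on_def shift_def by (simp add: add.commute)

lemma shift_shift: "shift m (shift n e) = shift (m + n) e"
  by (simp add: shift_def add.assoc)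

lemma shift_0 [simp]: "shift 0 e = e"
  by (simp add: shift_def)

lemma shift_upd: "shift m (e(a := x)) = (shift m e)(a - m := x)"
  by (auto simp: shift_def)

lemma iterate_mono:
  "\<forall>e. P e \<longrightarrow> Q e \<Longrightarrow> iterate U P a k e \<Longrightarrow> iterate U Q a k e"
  by (induction k arbitrary: a e) (auto elim: eventually_mono)

lemma iterate_conj:
  "iterate U P a k e \<Longrightarrow> iterate U Q a k e \<Longrightarrow> iterate U (\<lambda>e. P e \<and> Q e) a k e"
proof (induction k arbitrary: a e)
  case (Suc k)
  from Suc.prems have "\<forall>\<^sub>F x in U. iterate U P (a + 1) k (e(a := x))"
    "\<forall>\<^sub>F x in U. iterate U Q (a + 1) k (e(a := x))" by simp_all
  then show ?case unfolding iterate.simps by (rule eventually_elim2) (rule Suc.IH)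
qed simp

lemma iterate_not:
  assumes "ultrafilter U"
  shows "iterate U (\<lambda>e. \<not> P e) a k e \<longleftrightarrow> \<not> iterate U P a k e"
  by (induction k arbitrary: a e) (simp_all add: ultrafilter_not[OF assms])

lemma iterate_cong:
  assumes "\<And>e'. (\<And>i. i \<notin> {a..<a + int k} \<Longrightarrow> e' i = e i) \<Longrightarrow> P e' = Q e'"
  shows "iterate U P a k e = iterate U Q a k e"
  using assms
proof (induction k arbitrary: a e)
  case (Suc k)
  have "iterate U P (a + 1) k (e(a := x)) = iterate U Q (a + 1) k (e(a := x))" for x
    by (rule Suc.IH, rule Suc.prems) auto
  then show ?case by simp
qed auto

lemma iterate_const:
  assumes "ultrafilter U" 
  shows "iterate U (\<lambda>e. P) a k e = P"
  by (induction k arbitrary: a e) (auto simp: ultrafilter_const[OF assms])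

lemma iterate_idle:
  assumes "ultrafilter U" "depends_on S P" "S \<inter> {a..<a + int k} = {}"
  shows "iterate U P a k e = P e"
proof -
  have "iterate U P a k e = iterate U (\<lambda>_. P e) a k e"
    using assms(3) by (intro iterate_cong depends_onD[OF assms(2)]) blast
  then show ?thesis by (simp add: iterate_const[OF assms(1)])
qed

lemma iterate_append:
  "iterate U P a (k + l) e = iterate U (iterate U P (a + int k) l) a k e"
  by (induction k arbitrary: a e) (simp_all add: algebra_simps)

lemma depends_on_iterate:
  assumes "depends_on S P"
  shows "depends_on (S - {a..<a + int k}) (iterate U P a k)"
proof (induction k arbitrary: a)
  case 0
  then show ?case using assms by (simp add: depends_on_def)
next
  case (Suc k)
  have "iterate U P a (Suc k) e = iterate U P a (Suc k) e'"
    if "\<forall>i\<in>S - {a..<a + int (Suc k)}. e i = e' i" for e e'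
  proof -
    have "iterate U P (a + 1) k (e(a := x)) = iterate U P (a + 1) k (e'(a := x))" for x
      using that by (intro depends_onD[OF Suc]) auto
    then show ?thesis by simp
  qed
  then show ?case unfolding depends_on_def by blast
qed

lemma iterate_shift:
  "iterate U (\<lambda>e. P (shift m e)) a k e = iterate U P (a - m) k (shift m e)"
  by (induction k arbitrary: a e) (simp_all add: shift_upd algebra_simps)

text \<open>Cut the large block into the coordinates before, inside and after the window. Those
  after are idle for \<open>P\<close>; once the window is quantified nothing is left to depend on,
  so those before are idle too and the starting family is irrelevant.\<close>

lemma iterate_window:
  assumes U: "ultrafilter U" and P: "depends_on {a..<a + int k} P"
    and "b \<le> a" "a + int k \<le> b + int l"
  shows "iterate U P b l e = iterate U P a k e'"
proof -
  obtain c where c: "a = b + int c" using assms(3) by (metis zle_iff_zadd)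
  obtain d where d: "l = c + (k + d)"
    using assms(4) c by (metis add.assoc add_le_cancel_left nat_le_iff_add of_nat_add of_nat_le_iff)
  have inner: "iterate U P (a + int k) d = P"
    by (intro ext iterate_idle[OF U P]) auto
  have dep: "depends_on {} (iterate U P a k)"
    using depends_on_iterate[OF P, of a k U] by simp
  have "iterate U P b l e = iterate U (iterate U (iterate U P (a + int k) d) a k) b c e"
    unfolding d c iterate_append by (simp add: fun_eq_iff iterate_append[abs_def])
  also have "\<dots> = iterate U P a k e"
    unfolding inner by (intro iterate_idle[OF U dep]) auto
  also have "\<dots> = iterate U P a k e'"
    by (intro depends_onD[OF dep]) auto
  finally show ?thesis .
qed

lemma iterate_happens:
  assumes "ultrafilter U" "iterate U P a k e"
  shows "\<exists>e'. P e'"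
  using assms iterate_const[OF assms(1), of False] iterate_mono[of P "\<lambda>_. False"] by blast

section \<open>The limit filter and its refinements\<close>

text \<open>The windows from \<open>-n\<close> to \<open>n - 1\<close> exhaust the integers, and a
  predicate of finite support has a stable value once they cover that support; for such predicates
  the starting family does not matter. Predicates of infinite support may remain undecided, which is
  why an ultrafilter below this filter is chosen later.\<close>

definition iterated_filter :: "'j filter \<Rightarrow> (int \<Rightarrow> 'j) filter" where
  "iterated_filter U =
     Abs_filter (\<lambda>P. \<forall>\<^sub>F n in sequentially. iterate U P (- int n) (2 * n) (\<lambda>_. undefined))"

lemma eventually_iterated_filter:
  "eventually P (iterated_filter U) \<longleftrightarrow>
     (\<forall>\<^sub>F n in sequentially. iterate U P (- int n) (2 * n) (\<lambda>_. undefined))"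
  unfolding iterated_filter_def
proof (rule eventually_Abs_filter, unfold_locales)
  have "iterate U (\<lambda>x. True) a k e" for a k e
    by (induction k arbitrary: a e) auto
  then show "\<forall>\<^sub>F n in sequentially. iterate U (\<lambda>x. True) (- int n) (2 * n) (\<lambda>_. undefined)"
    by simp
next
  fix P Q :: "(int \<Rightarrow> 'a) \<Rightarrow> bool"
  assume "\<forall>\<^sub>F n in sequentially. iterate U P (- int n) (2 * n) (\<lambda>_. undefined)"
    "\<forall>\<^sub>F n in sequentially. iterate U Q (- int n) (2 * n) (\<lambda>_. undefined)"
  then show "\<forall>\<^sub>F n in sequentially. iterate U (\<lambda>e. P e \<and> Q e) (- int n) (2 * n) (\<lambda>_. undefined)"
    by (rule eventually_elim2) (rule iterate_conj)
next
  fix P Q :: "(int \<Rightarrow> 'a) \<Rightarrow> bool"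
  assume "\<forall>e. P e \<longrightarrow> Q e" "\<forall>\<^sub>F n in sequentially. iterate U P (- int n) (2 * n) (\<lambda>_. undefined)"
  then show "\<forall>\<^sub>F n in sequentially. iterate U Q (- int n) (2 * n) (\<lambda>_. undefined)"
    by (auto elim!: eventually_mono intro: iterate_mono)
qed

text \<open>The iterated filter already decides between \<open>P\<close> and its negation when the
  support lies in a finite interval, so every ultrafilter refining it must agree.\<close>

lemma ultrafilter_iterated:
  assumes U: "ultrafilter U" and D: "ultrafilter D" "D \<le> iterated_filter U"
    and P: "depends_on {a..<a + int k} P"
  shows "eventually P D \<longleftrightarrow> iterate U P a k e"
proof -
  have *: "eventually Q D" if Q: "depends_on {a..<a + int k} Q" "iterate U Q a k e" for Q
  proof -
    have "iterate U Q (- int n) (2 * n) (\<lambda>_. undefined)" if "n \<ge> nat (\<bar>a\<bar> + int k)" for n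
      using iterate_window[OF U Q(1), of "- int n" "2 * n" _ e] that Q(2) by auto
    then have "eventually Q (iterated_filter U)"
      unfolding eventually_iterated_filter eventually_sequentially by blast
    then show ?thesis using D(2) by (auto simp: le_filter_def)
  qed
  have "depends_on {a..<a + int k} (\<lambda>e. \<not> P e)" using P by (simp add: depends_on_def)
  then show ?thesis
    using *[of P] *[of "\<lambda>e. \<not> P e"] P iterate_not[OF U, of P] ultrafilter_not[OF D(1), of P] by blast
qed

lemma iterated_filter_ne_bot:
  assumes "ultrafilter U"
  shows "iterated_filter U \<noteq> bot"
  by (simp add: trivial_limit_def eventually_iterated_filter iterate_const[OF assms])

text \<open>Iterating over a window is insensitive to the position of the window. The support must
  be finite: the choice of \<open>D\<close> gives no control over the translation of other
  predicates.\<close>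

lemma eventually_shift:
  assumes U: "ultrafilter U" and D: "ultrafilter D" "D \<le> iterated_filter U"
    and P: "depends_on {a..<a + int k} P"
  shows "eventually (\<lambda>e. P (shift m e)) D \<longleftrightarrow> eventually P D"
proof -
  have "depends_on {a + m..<a + m + int k} (\<lambda>e. P (shift m e))"
    using depends_on_shift[OF P, of m] by (simp add: algebra_simps)
  from ultrafilter_iterated[OF U D this] have
    "eventually (\<lambda>e. P (shift m e)) D \<longleftrightarrow> iterate U P a k (shift m undefined)"
    using iterate_shift[of U P m "a + m" k] by simp
  also have "\<dots> \<longleftrightarrow> eventually P D"
    by (rule ultrafilter_iterated[OF U D P, symmetric])
  finally show ?thesis .
qed

text \<open>The coordinates of \<open>x\<close> are all quantified before those of its translate, so fixing the former
  exhibits a value which the translate takes almost everywhere.\<close>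

lemma shift_fixed_imp_constant:
  assumes U: "ultrafilter U" and D: "ultrafilter D" "D \<le> iterated_filter U"
    and x: "depends_on {- int n..<int n} x" and m: "2 * n \<le> m"
    and fixed: "\<forall>\<^sub>F e in D. x (shift (int m) e) = x e"
  shows "\<exists>a. \<forall>\<^sub>F e in D. x e = a"
proof -
  let ?P = "\<lambda>e. x (shift (int m) e) = x e"
  have x': "depends_on {int m - int n..<int m + int n} (\<lambda>e. x (shift (int m) e))"
    using depends_on_shift[OF x, of "int m"] by (simp add: algebra_simps)
  \<comment> \<open>The supports of \<open>x\<close> and of its translate both lie in one interval
    of length \<open>2 * n + m\<close> starting at \<open>- n\<close>.\<close>
  have P: "depends_on {- int n..<- int n + int (2 * n + m)} ?P"
    unfolding depends_on_def
  proof (intro allI impI)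
    fix e e' :: "int \<Rightarrow> 'a"
    assume "\<forall>i\<in>{- int n..<- int n + int (2 * n + m)}. e i = e' i"
    then have "x e = x e'" "x (shift (int m) e) = x (shift (int m) e')"
      using m by (auto intro!: depends_onD[OF x] depends_onD[OF x'])
    then show "?P e = ?P e'" by simp
  qed
  \<comment> \<open>Cut after the first \<open>2 * n\<close> coordinates, which carry
    \<open>x\<close>. The remaining block starts at \<open>n\<close> and, since
    \<open>n \<le> m - n\<close>, contains the whole support of the translate.\<close>
  have "iterate U (iterate U ?P (- int n + int (2 * n)) m) (- int n) (2 * n) undefined"
    using ultrafilter_iterated[OF U D P, of undefined] fixed unfolding iterate_append by blast
  then obtain e where e: "iterate U ?P (- int n + int (2 * n)) m e"
    using iterate_happens[OF U] by blast
  \<comment> \<open>The inner quantifiers change no coordinate that \<open>x\<close> reads, so the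
    value of \<open>x\<close> is frozen at \<open>x e\<close>.\<close>
  have "iterate U (\<lambda>e'. x (shift (int m) e') = x e) (int n) m e =
      iterate U ?P (int n) m e"
  proof (rule iterate_cong)
    fix e' assume "\<And>i. i \<notin> {int n..<int n + int m} \<Longrightarrow> e' i = e i"
    then have "x e' = x e" by (intro depends_onD[OF x]) auto
    then show "(x (shift (int m) e') = x e) = (x (shift (int m) e') = x e')" by simp
  qed
  with e have "iterate U (\<lambda>e'. x (shift (int m) e') = x e) (int n) m e" by simp
  moreover have "depends_on {int n..<int n + int m} (\<lambda>e'. x (shift (int m) e') = x e)"
    using depends_on_mono[OF x', of "{int n..<int n + int m}"] m
    by (simp add: depends_on_def) metis
  ultimately have "\<forall>\<^sub>F e' in D. x (shift (int m) e') = x e"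
    using ultrafilter_iterated[OF U D] by blast
  moreover have "depends_on {- int n..<- int n + int (2 * n)} (\<lambda>e'. x e' = x e)"
    using x by (simp add: depends_on_def) metis
  ultimately have "\<forall>\<^sub>F e' in D. x e' = x e"
    using eventually_shift[OF U D, of "- int n" "2 * n" "\<lambda>e'. x e' = x e" "int m"] by blast
  then show ?thesis ..
qed

section \<open>Ultrapowers of definable functions\<close>

lemma isomorphism_eval:
  assumes "isomorphism h M N" "is_structure M" "range s \<subseteq> universe M" "wf_tm (lang M) t"
  shows "eval M s t \<in> universe M \<and> eval N (\<lambda>i. h (s i)) t = h (eval M s t)"
  using assms(4)
proof (induction t)
  case (Var n)
  then show ?case using assms(3) by auto
next
  case (App f ts)
  then have "map (eval M s) ts \<in> tuples (universe M) (fun_arity (lang M) f)" "f \<in> funs (lang M)"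
    by (auto simp: tuples_def)
  moreover have "map (eval N (\<lambda>i. h (s i))) ts = map h (map (eval M s) ts)"
    using App by simp
  ultimately show ?case
    using assms(1,2) unfolding isomorphism_def is_structure_def by (simp cong: map_cong)
qed

lemma isomorphism_sat:
  assumes iso: "isomorphism h M N" and M: "is_structure M"
    and "range s \<subseteq> universe M" "wf_fm (lang M) \<phi>"
  shows "sat N (\<lambda>i. h (s i)) \<phi> \<longleftrightarrow> sat M s \<phi>"
  using assms(3,4)
proof (induction \<phi> arbitrary: s)
  case (Eq t u)
  then show ?case
    using isomorphism_eval[OF iso M Eq(1)] iso
    by (auto simp: isomorphism_def bij_betw_def inj_on_eq_iff)
next
  case (Atom R ts)
  then have "map (eval M s) ts \<in> tuples (universe M) (rel_arity (lang M) R)" "R \<in> rels (lang M)"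
    using isomorphism_eval[OF iso M Atom(1)] by (auto simp: tuples_def)
  moreover have "map (eval N (\<lambda>i. h (s i))) ts = map h (map (eval M s) ts)"
    using Atom isomorphism_eval[OF iso M Atom(1)] by simp
  ultimately show ?case using iso unfolding isomorphism_def by (simp cong: map_cong)
next
  case (Exi n \<phi>)
  have "sat N ((\<lambda>i. h (s i))(n := h a)) \<phi> \<longleftrightarrow> sat M (s(n := a)) \<phi>" if "a \<in> universe M" for a
  proof -
    have "(\<lambda>i. h (s i))(n := h a) = (\<lambda>i. h ((s(n := a)) i))" by auto
    moreover have "range (s(n := a)) \<subseteq> universe M" using Exi.prems(1) that by auto
    ultimately show ?thesis using Exi.IH[of "s(n := a)"] Exi.prems(2) by (simp only: wf_fm.simps)
  qed
  moreover have "universe N = h ` universe M" using iso by (auto simp: isomorphism_def bij_betw_def)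
  ultimately show ?case by auto
qed auto

lemma is_structure_copy:
  assumes "is_structure M" "inj_on h (universe M)"
  shows "is_structure (copy h M)"
  unfolding is_structure_def
proof (intro conjI ballI)
  show "universe (copy h M) \<noteq> {}" using assms by (simp add: copy_def is_structure_def)
next
  fix f xs
  assume "f \<in> funs (lang (copy h M))"
    and xs: "xs \<in> tuples (universe (copy h M)) (fun_arity (lang (copy h M)) f)"
  moreover from xs have "map (inv_into (universe M) h) xs \<in> tuples (universe M) (fun_arity (lang M) f)"
    by (auto simp: copy_def tuples_def subset_iff inv_into_into)
  ultimately show "fun_interp (copy h M) f xs \<in> universe (copy h M)"
    using assms(1) by (simp add: copy_def is_structure_def)
qed

lemma depends_on_eval: "\<exists>n. depends_on {..<n::nat} (\<lambda>s. eval M s t)"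
proof (induction t)
  case (Var k)
  have "depends_on {..<Suc k} (\<lambda>s. eval M s (Var k))" by (simp add: depends_on_def)
  then show ?case ..
next
  case (App f ts)
  have "\<exists>n. depends_on {..<n::nat} (\<lambda>s. map (eval M s) ts)"
    using App by (intro depends_on_list) (auto simp: mono_def)
  then show ?case using depends_on_compose[where g="fun_interp M f"] by auto
qed

text \<open>A crude bound on the relevant variables replaces the set of free variables. It lets a
  Skolem function receive a finite initial segment of an assignment instead of the whole
  assignment.\<close>

lemma depends_on_sat: "\<exists>n. depends_on {..<n::nat} (\<lambda>s. sat M s \<phi>)"
proof -
  have mono: "mono lessThan" by (auto simp: mono_def)
  have tms: "\<exists>n. depends_on {..<n::nat} (\<lambda>s. map (eval M s) ts)" for ts
    by (intro depends_on_list[OF mono] depends_on_eval)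
  show ?thesis
  proof (induction \<phi>)
    case (Eq t u)
    obtain n where "depends_on {..<n} (\<lambda>s. map (eval M s) [t, u])"
      using tms by blast
    from depends_on_compose[OF this, of "\<lambda>vs. vs ! 0 = vs ! 1"] show ?case by auto
  next
    case (Atom R ts)
    obtain n where "depends_on {..<n} (\<lambda>s. map (eval M s) ts)"
      using tms by blast
    from depends_on_compose[OF this, of "rel_interp M R"] show ?case by auto
  next
    case (Neg \<phi>)
    then obtain n where "depends_on {..<n} (\<lambda>s. sat M s \<phi>)" ..
    from depends_on_compose[OF this, of Not] show ?case by auto
  next
    case (Conj \<phi> \<psi>)
    then have "\<exists>n. depends_on {..<n} (\<lambda>s. map (sat M s) [\<phi>, \<psi>])"
      by (intro depends_on_list[OF mono]) auto
    then obtain n where "depends_on {..<n} (\<lambda>s. map (sat M s) [\<phi>, \<psi>])" ..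
    from depends_on_compose[OF this, of "\<lambda>vs. vs ! 0 \<and> vs ! 1"] show ?case by auto
  next
    case (Exi k \<phi>)
    then obtain n where n: "depends_on {..<n} (\<lambda>s. sat M s \<phi>)" ..
    have "sat M s (Exi k \<phi>) = sat M s' (Exi k \<phi>)" if "\<forall>i\<in>{..<n}. s i = s' i" for s s'
    proof -
      have "sat M (s(k := a)) \<phi> = sat M (s'(k := a)) \<phi>" for a
        using that by (intro depends_onD[OF n]) auto
      then show ?thesis by simp
    qed
    then show ?case unfolding depends_on_def by blast
  qed
qed

section \<open>Restricted ultrapowers and the theorem of Los\<close>

text \<open>Classes modulo \<open>D\<close> are represented by the values of a map \<open>h\<close>
  whose kernel on \<open>F\<close> is equality almost everywhere; this leaves the target type free
  and places constants exactly at their copies under \<open>\<iota>\<close>.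
  \<open>F_witness\<close> asks for one member of \<open>F\<close> that supplies witnesses at all
  points at once, so that \<open>F\<close> need not contain all functions.\<close>

locale definable_ultrapower =
  fixes M :: "('a, 'f, 'r) struct" and D :: "'e filter" and F :: "('e \<Rightarrow> 'a) set"
    and h :: "('e \<Rightarrow> 'a) \<Rightarrow> 'b" and \<iota> :: "'a \<Rightarrow> 'b"
  assumes base_structure: "is_structure M" and ultra: "ultrafilter D"
    and F_universe: "x \<in> F \<Longrightarrow> x e \<in> universe M"
    and F_const: "a \<in> universe M \<Longrightarrow> (\<lambda>_. a) \<in> F"
    and F_fun: "f \<in> funs (lang M) \<Longrightarrow> xs \<in> tuples F (fun_arity (lang M) f) \<Longrightarrow>
      (\<lambda>e. fun_interp M f (map (\<lambda>x. x e) xs)) \<in> F"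
    and F_witness: "wf_fm (lang M) \<phi> \<Longrightarrow> range s \<subseteq> F \<Longrightarrow>
      \<exists>x \<in> F. \<forall>e. (\<exists>a \<in> universe M. sat M ((\<lambda>i. s i e)(n := a)) \<phi>) \<longrightarrow>
        sat M ((\<lambda>i. s i e)(n := x e)) \<phi>"
    and h_eq_iff: "x \<in> F \<Longrightarrow> y \<in> F \<Longrightarrow> h x = h y \<longleftrightarrow> (\<forall>\<^sub>F e in D. x e = y e)"
    and h_const: "a \<in> universe M \<Longrightarrow> h (\<lambda>_. a) = \<iota> a"
begin

definition rep :: "'b \<Rightarrow> 'e \<Rightarrow> 'a" where
  "rep = inv_into F h"

definition power :: "('b, 'f, 'r) struct" where
  "power = \<lparr>lang = lang M, universe = h ` F,
     fun_interp = (\<lambda>f ys. h (\<lambda>e. fun_interp M f (map (\<lambda>y. rep y e) ys))),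
     rel_interp = (\<lambda>R ys. \<forall>\<^sub>F e in D. rel_interp M R (map (\<lambda>y. rep y e) ys))\<rparr>"

lemma lang_power [simp]: "lang power = lang M"
  and universe_power [simp]: "universe power = h ` F"
  by (simp_all add: power_def)

lemma rep_in_F: "y \<in> h ` F \<Longrightarrow> rep y \<in> F"
  by (simp add: rep_def inv_into_into)

lemma eventually_rep: "x \<in> F \<Longrightarrow> \<forall>\<^sub>F e in D. rep (h x) e = x e"
  using h_eq_iff[OF rep_in_F, of "h x" x] by (simp add: rep_def f_inv_into_f)

lemma eventually_map_rep:
  assumes "set xs \<subseteq> F"
  shows "\<forall>\<^sub>F e in D. map (\<lambda>y. rep y e) (map h xs) = map (\<lambda>x. x e) xs"
  using assms
proof (induction xs)
  case (Cons x xs)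
  then have "\<forall>\<^sub>F e in D. rep (h x) e = x e"
    "\<forall>\<^sub>F e in D. map (\<lambda>y. rep y e) (map h xs) = map (\<lambda>x. x e) xs"
    by (simp_all add: eventually_rep)
  then show ?case by (rule eventually_elim2) simp
qed simp

text \<open>The operations of \<open>power\<close> are defined through chosen representatives; any
  other representatives agree with them almost everywhere, simultaneously for the finitely many
  arguments.\<close>

lemma fun_interp_power:
  assumes f: "f \<in> funs (lang M)" and xs: "xs \<in> tuples F (fun_arity (lang M) f)"
  shows "fun_interp power f (map h xs) = h (\<lambda>e. fun_interp M f (map (\<lambda>x. x e) xs))"
proof -
  have "map rep (map h xs) \<in> tuples F (fun_arity (lang M) f)"
    using xs by (auto simp: tuples_def rep_in_F)
  from F_fun[OF f this] have "(\<lambda>e. fun_interp M f (map (\<lambda>y. rep y e) (map h xs))) \<in> F"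
    by (simp add: comp_def)
  moreover have "\<forall>\<^sub>F e in D. fun_interp M f (map (\<lambda>y. rep y e) (map h xs))
      = fun_interp M f (map (\<lambda>x. x e) xs)"
  proof (rule eventually_mono)
    show "\<forall>\<^sub>F e in D. map (\<lambda>y. rep y e) (map h xs) = map (\<lambda>x. x e) xs"
      using xs by (intro eventually_map_rep) (auto simp: tuples_def)
  qed (simp only:)
  ultimately show ?thesis using F_fun[OF f xs] h_eq_iff by (simp add: power_def)
qed

lemma rel_interp_power:
  assumes "set xs \<subseteq> F"
  shows "rel_interp power R (map h xs) \<longleftrightarrow> (\<forall>\<^sub>F e in D. rel_interp M R (map (\<lambda>x. x e) xs))"
proof -
  have "(\<forall>\<^sub>F e in D. rel_interp M R (map (\<lambda>y. rep y e) (map h xs))) \<longleftrightarrow>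
      (\<forall>\<^sub>F e in D. rel_interp M R (map (\<lambda>x. x e) xs))"
    by (intro eventually_cong[OF eventually_map_rep[OF assms]]) (simp only:)
  then show ?thesis by (simp add: power_def)
qed

lemma tuples_power:
  assumes "ys \<in> tuples (universe power) n"
  obtains xs where "xs \<in> tuples F n" "ys = map h xs"
proof
  show "map rep ys \<in> tuples F n" using assms by (auto simp: tuples_def rep_in_F)
  show "ys = map h (map rep ys)"
    using assms by (auto simp: tuples_def rep_def f_inv_into_f subset_iff intro!: map_idI[symmetric])
qed

lemma is_structure_power: "is_structure power"
  unfolding is_structure_def
proof (intro conjI ballI)
  show "universe power \<noteq> {}" using base_structure F_const by (auto simp: is_structure_def)
next
  fix f ys
  assume f: "f \<in> funs (lang power)" and "ys \<in> tuples (universe power) (fun_arity (lang power) f)"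
  then obtain xs where "xs \<in> tuples F (fun_arity (lang M) f)" "ys = map h xs"
    using tuples_power by auto
  then show "fun_interp power f ys \<in> universe power"
    using f fun_interp_power F_fun by simp
qed

lemma eval_power:
  assumes "range s \<subseteq> F" "wf_tm (lang M) t"
  shows "(\<lambda>e. eval M (\<lambda>i. s i e) t) \<in> F \<and> eval power (\<lambda>i. h (s i)) t = h (\<lambda>e. eval M (\<lambda>i. s i e) t)"
  using assms(2)
proof (induction t)
  case (Var n)
  then show ?case using assms(1) by auto
next
  case (App f ts)
  let ?xs = "map (\<lambda>t e. eval M (\<lambda>i. s i e) t) ts"
  have f: "f \<in> funs (lang M)" and xs: "?xs \<in> tuples F (fun_arity (lang M) f)"
    using App by (auto simp: tuples_def)
  have "map (eval power (\<lambda>i. h (s i))) ts = map h ?xs" using App by simp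
  then show ?case using fun_interp_power[OF f xs] F_fun[OF f xs] by (simp add: comp_def cong: map_cong)
qed

theorem Los:
  assumes "range s \<subseteq> F" "wf_fm (lang M) \<phi>"
  shows "sat power (\<lambda>i. h (s i)) \<phi> \<longleftrightarrow> (\<forall>\<^sub>F e in D. sat M (\<lambda>i. s i e) \<phi>)"
  using assms
proof (induction \<phi> arbitrary: s)
  case (Eq t u)
  then show ?case using eval_power[OF Eq(1)] h_eq_iff by simp
next
  case (Atom R ts)
  let ?xs = "map (\<lambda>t e. eval M (\<lambda>i. s i e) t) ts"
  have "set ?xs \<subseteq> F" using Atom eval_power[OF Atom(1)] by auto
  moreover have "map (eval power (\<lambda>i. h (s i))) ts = map h ?xs"
    using Atom eval_power[OF Atom(1)] by simp
  ultimately show ?case using rel_interp_power[of ?xs R] by (simp add: comp_def cong: map_cong)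
next
  case (Neg \<phi>)
  then show ?case by (simp add: ultrafilter_not[OF ultra])
next
  case (Conj \<phi> \<psi>)
  then show ?case by (simp add: eventually_conj_iff)
next
  case (Exi n \<phi>)
  have upd: "sat power ((\<lambda>i. h (s i))(n := h x)) \<phi> \<longleftrightarrow>
      (\<forall>\<^sub>F e in D. sat M ((\<lambda>i. s i e)(n := x e)) \<phi>)" if "x \<in> F" for x
  proof -
    have "(\<lambda>i. h (s i))(n := h x) = (\<lambda>i. h ((s(n := x)) i))"
      "\<And>e. (\<lambda>i. s i e)(n := x e) = (\<lambda>i. (s(n := x)) i e)" by auto
    moreover have "range (s(n := x)) \<subseteq> F" using Exi.prems(1) that by auto
    ultimately show ?thesis using Exi.IH[of "s(n := x)"] Exi.prems(2) by (simp only: wf_fm.simps)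
  qed
  \<comment> \<open>This \<open>x\<close> serves the direction from truth almost everywhere to truth
    in \<open>power\<close>; the converse uses only that members of \<open>F\<close> take values in
    the universe.\<close>
  obtain x where x: "x \<in> F" "\<forall>e. (\<exists>a \<in> universe M. sat M ((\<lambda>i. s i e)(n := a)) \<phi>) \<longrightarrow>
        sat M ((\<lambda>i. s i e)(n := x e)) \<phi>"
    using F_witness[OF _ Exi.prems(1), of \<phi> n] Exi.prems(2) by auto
  show ?case
  proof
    assume "sat power (\<lambda>i. h (s i)) (Exi n \<phi>)"
    then obtain y where "y \<in> F" "\<forall>\<^sub>F e in D. sat M ((\<lambda>i. s i e)(n := y e)) \<phi>"
      using upd by auto
    then show "\<forall>\<^sub>F e in D. sat M (\<lambda>i. s i e) (Exi n \<phi>)"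
      using F_universe by (auto elim!: eventually_mono)
  next
    assume "\<forall>\<^sub>F e in D. sat M (\<lambda>i. s i e) (Exi n \<phi>)"
    then have "\<forall>\<^sub>F e in D. sat M ((\<lambda>i. s i e)(n := x e)) \<phi>"
      using x(2) by (auto elim!: eventually_mono)
    then show "sat power (\<lambda>i. h (s i)) (Exi n \<phi>)" using x(1) upd by auto
  qed
qed

lemma inj_embedding: "inj_on \<iota> (universe M)"
proof (rule inj_onI)
  fix a b assume "a \<in> universe M" "b \<in> universe M" "\<iota> a = \<iota> b"
  then have "\<forall>\<^sub>F e in D. a = b"
    using h_eq_iff[OF F_const F_const, of a b] h_const by simp
  then show "a = b" using ultrafilter_const[OF ultra] by simp
qed

text \<open>The copied elements are the classes of constant functions. For these the theorem of Los
  speaks of a predicate not depending on \<open>e\<close>, which an ultrafilter makes eventual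
  exactly when it is true.\<close>

theorem elementary_extension_power: "elementary_extension (copy \<iota> M) power"
proof -
  have iso: "isomorphism \<iota> M (copy \<iota> M)" by (rule isomorphism_copy[OF inj_embedding])
  have univ: "universe (copy \<iota> M) = \<iota> ` universe M" and lang: "lang (copy \<iota> M) = lang M"
    by (simp_all add: copy_def)
  \<comment> \<open>Each tuple over the copy is read in two ways: as the image of a tuple of
    \<open>M\<close>, and as classes of constant functions.\<close>
  have tuple: "\<exists>as. as \<in> tuples (universe M) n \<and> ys = map \<iota> as \<and>
      map (\<lambda>a _. a) as \<in> tuples F n \<and> ys = map h (map (\<lambda>a _. a) as)"
    if "ys \<in> tuples (universe (copy \<iota> M)) n" for ys n
  proof -
    have "ys \<in> lists (\<iota> ` universe M)" using that univ by (auto simp: tuples_def)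
    then obtain as where as: "as \<in> lists (universe M)" "ys = map \<iota> as"
      by (auto simp: lists_image)
    moreover have "map h (map (\<lambda>a _. a) as) = map \<iota> as" using as h_const by auto
    ultimately show ?thesis using that F_const by (intro exI[of _ as]) (auto simp: tuples_def)
  qed
  have "substructure (copy \<iota> M) power"
    unfolding substructure_def
  proof (intro conjI ballI)
    show "is_structure (copy \<iota> M)" by (rule is_structure_copy[OF base_structure inj_embedding])
    show "is_structure power" by (rule is_structure_power)
    show "lang power = lang (copy \<iota> M)" by (simp add: lang)
    show "universe (copy \<iota> M) \<subseteq> universe power"
      using F_const h_const by (force simp: univ)
  next
    fix f ys assume f: "f \<in> funs (lang (copy \<iota> M))"
      and "ys \<in> tuples (universe (copy \<iota> M)) (fun_arity (lang (copy \<iota> M)) f)"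
    then obtain as where as: "as \<in> tuples (universe M) (fun_arity (lang M) f)" "ys = map \<iota> as"
        "map (\<lambda>a _. a) as \<in> tuples F (fun_arity (lang M) f)" "ys = map h (map (\<lambda>a _. a) as)"
      using tuple unfolding lang by blast
    have "fun_interp power f ys = h (\<lambda>e. fun_interp M f as)"
      unfolding as(4) using fun_interp_power[OF _ as(3)] f lang by (simp add: comp_def)
    also have "\<dots> = \<iota> (fun_interp M f as)"
      using base_structure f lang as(1) by (intro h_const) (auto simp: is_structure_def)
    also have "\<dots> = fun_interp (copy \<iota> M) f ys"
      using iso as(1,2) f lang by (simp add: isomorphism_def)
    finally show "fun_interp power f ys = fun_interp (copy \<iota> M) f ys" .
  next
    fix R ys assume R: "R \<in> rels (lang (copy \<iota> M))"
      and "ys \<in> tuples (universe (copy \<iota> M)) (rel_arity (lang (copy \<iota> M)) R)"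
    then obtain as where as: "as \<in> tuples (universe M) (rel_arity (lang M) R)" "ys = map \<iota> as"
        "map (\<lambda>a _. a) as \<in> tuples F (rel_arity (lang M) R)" "ys = map h (map (\<lambda>a _. a) as)"
      using tuple unfolding lang by blast
    have "rel_interp power R ys \<longleftrightarrow> (\<forall>\<^sub>F e in D. rel_interp M R as)"
      unfolding as(4) using rel_interp_power[of "map (\<lambda>a _. a) as" R] as(3)
      by (simp add: comp_def tuples_def)
    also have "\<dots> \<longleftrightarrow> rel_interp M R as" by (rule ultrafilter_const[OF ultra])
    also have "\<dots> \<longleftrightarrow> rel_interp (copy \<iota> M) R ys"
      using iso as(1,2) R lang by (simp add: isomorphism_def)
    finally show "rel_interp power R ys \<longleftrightarrow> rel_interp (copy \<iota> M) R ys" .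
  qed
  moreover have "sat (copy \<iota> M) s \<phi> \<longleftrightarrow> sat power s \<phi>"
    if \<phi>: "wf_fm (lang M) \<phi>" and s: "range s \<subseteq> \<iota> ` universe M" for s \<phi>
  proof -
    have "\<forall>i. \<exists>a. a \<in> universe M \<and> s i = \<iota> a" using s by blast
    then obtain r where r: "\<And>i. r i \<in> universe M" "\<And>i. s i = \<iota> (r i)" by metis
    have "sat (copy \<iota> M) (\<lambda>i. \<iota> (r i)) \<phi> \<longleftrightarrow> sat M r \<phi>"
      using r(1) by (intro isomorphism_sat[OF iso base_structure _ \<phi>]) auto
    also have "\<dots> \<longleftrightarrow> (\<forall>\<^sub>F e in D. sat M (\<lambda>i. r i) \<phi>)"
      by (simp add: ultrafilter_const[OF ultra])
    also have "\<dots> \<longleftrightarrow> sat power (\<lambda>i. h (\<lambda>_. r i)) \<phi>"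
      using Los[of "\<lambda>i _. r i", OF _ \<phi>] r(1) F_const by auto
    finally show ?thesis by (simp only: h_const[OF r(1)] r(2)[symmetric])
  qed
  ultimately show ?thesis by (simp add: elementary_extension_def lang univ)
qed

end

section \<open>The extension\<close>

text \<open>The sets \<open>X (S, B)\<close> are nonempty because \<open>A\<close> minus a finite
  set is still infinite, and directed by taking unions of the parameters. They generate a proper
  filter, and any ultrafilter refining it has the three properties.\<close>

lemma independent_ultrafilter:
  fixes A :: "'a set"
  assumes A: "infinite A"
  obtains U :: "('k \<Rightarrow> 'a) filter" where "ultrafilter U"
    "\<And>k. \<forall>\<^sub>F j in U. j k \<in> A" "\<And>k a. \<forall>\<^sub>F j in U. j k \<noteq> a"
    "\<And>k l. k \<noteq> l \<Longrightarrow> \<forall>\<^sub>F j in U. j k \<noteq> j l"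
proof -
  let ?I = "{S :: 'k set. finite S} \<times> {B :: 'a set. finite B}"
  define X :: "'k set \<times> 'a set \<Rightarrow> ('k \<Rightarrow> 'a) set" where
    "X p = {j. inj_on j (fst p) \<and> j ` fst p \<subseteq> A - snd p}" for p
  define W where "W = (INF p \<in> ?I. principal (X p))"
  have W: "eventually P W \<longleftrightarrow> (\<exists>p \<in> ?I. \<forall>j \<in> X p. P j)" for P
    unfolding W_def
  proof (subst eventually_INF_base)
    fix p q assume "p \<in> ?I" "q \<in> ?I"
    then show "\<exists>r \<in> ?I. principal (X r) \<le> inf (principal (X p)) (principal (X q))"
      by (intro bexI[of _ "(fst p \<union> fst q, snd p \<union> snd q)"])
        (auto simp: X_def intro: inj_on_subset)
  qed (auto simp: eventually_principal)
  have ne: "X p \<noteq> {}" if "p \<in> ?I" for p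
  proof -
    have fin: "finite (fst p)" and "infinite (A - snd p)" using that A by auto
    from this(2) obtain T where T: "finite T" "card T = card (fst p)" "T \<subseteq> A - snd p"
      using infinite_arbitrarily_large by blast
    then obtain j where "bij_betw j (fst p) T"
      using finite_same_card_bij[OF fin, of T] by auto
    then have "j \<in> X p" using T(3) by (auto simp: X_def bij_betw_def)
    then show ?thesis by blast
  qed
  then have "W \<noteq> bot" unfolding trivial_limit_def W by blast
  then obtain U where U: "ultrafilter U" "U \<le> W" by (rule ultrafilter_exists)
  have ev: "eventually P U" if "finite S" "finite B" "\<And>j. j \<in> X (S, B) \<Longrightarrow> P j" for P S B
  proof -
    have "eventually P W" unfolding W using that by (intro bexI[of _ "(S, B)"]) auto
    then show ?thesis using U(2) by (simp add: le_filter_def)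
  qed
  show ?thesis
  proof (rule that[OF U(1)])
    show "\<forall>\<^sub>F j in U. j k \<in> A" for k by (rule ev[of "{k}" "{}"]) (auto simp: X_def)
    show "\<forall>\<^sub>F j in U. j k \<noteq> a" for k a by (rule ev[of "{k}" "{a}"]) (auto simp: X_def)
    show "\<forall>\<^sub>F j in U. j k \<noteq> j l" if "k \<noteq> l" for k l
      using that by (intro ev[of "{k, l}" "{}"]) (auto simp: X_def)
  qed
qed

section \<open>The definable functions of the coordinates\<close>

datatype ('a, 'k, 'f, 'r) operation =
  Constant 'a | Generator int 'k | Function 'f | Witness nat "('f, 'r) fm"

fun interp :: "('a, 'f, 'r) struct \<Rightarrow> ('a, 'k, 'f, 'r) operation \<Rightarrow> (int \<Rightarrow> 'k \<Rightarrow> 'a) \<Rightarrow> 'a list \<Rightarrow> 'a"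
  where
  "interp M (Constant a) e as = a"
| "interp M (Generator z k) e as = e z k"
| "interp M (Function f) e as = fun_interp M f as"
| "interp M (Witness n \<phi>) e as = (SOME a. a \<in> universe M \<and>
     sat M ((\<lambda>i. if i < length as then as ! i else undefined)(n := a)) \<phi>)"

text \<open>The closure applies a symbol to lists of any length; \<open>clamp\<close> keeps the result in the universe
  when the length differs from the arity, and for \<open>Witness\<close> when there is no witness.\<close>

definition clamp :: "'a set \<Rightarrow> 'a \<Rightarrow> 'a" where
  "clamp A a = (if a \<in> A then a else SOME b. b \<in> A)"

definition pointwise :: "('a, 'f, 'r) struct \<Rightarrow> ('a, 'k, 'f, 'r) operation \<Rightarrow>
    ((int \<Rightarrow> 'k \<Rightarrow> 'a) \<Rightarrow> 'a) list \<Rightarrow> (int \<Rightarrow> 'k \<Rightarrow> 'a) \<Rightarrow> 'a" where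
  "pointwise M g xs e = clamp (universe M) (interp M g e (map (\<lambda>x. x e) xs))"

definition operations :: "('a, 'f, 'r) struct \<Rightarrow> 'k set \<Rightarrow> ('a, 'k, 'f, 'r) operation set" where
  "operations M K = Constant ` universe M \<union> (\<lambda>(z, k). Generator z k) ` (UNIV \<times> K) \<union>
     Function ` funs (lang M) \<union> (\<lambda>(n, \<phi>). Witness n \<phi>) ` (UNIV \<times> {\<phi>. wf_fm (lang M) \<phi>})"

definition definable :: "('a, 'f, 'r) struct \<Rightarrow> 'k set \<Rightarrow> ((int \<Rightarrow> 'k \<Rightarrow> 'a) \<Rightarrow> 'a) set" where
  "definable M K = closure (pointwise M) (operations M K)"

lemma definableI:
  "g \<in> operations M K \<Longrightarrow> set xs \<subseteq> definable M K \<Longrightarrow> pointwise M g xs \<in> definable M K"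
  unfolding definable_def by (rule closure.step) auto

lemma clamp_in: "A \<noteq> {} \<Longrightarrow> clamp A a \<in> A"
  by (auto simp: clamp_def intro: someI)

lemma clamp_id: "a \<in> A \<Longrightarrow> clamp A a = a"
  by (simp add: clamp_def)

lemma definable_universe:
  assumes "universe M \<noteq> {}" "x \<in> definable M K"
  shows "x e \<in> universe M"
  using assms(2) unfolding definable_def
  by cases (simp add: pointwise_def clamp_in[OF assms(1)])

lemma definable_const:
  fixes K :: "'k set"
  assumes "a \<in> universe M"
  shows "(\<lambda>_. a) \<in> definable M K"
proof -
  have "pointwise M (Constant a) [] \<in> definable M K"
    using assms by (intro definableI) (auto simp: operations_def)
  moreover have "pointwise M (Constant a) [] = (\<lambda>_ :: int \<Rightarrow> 'k \<Rightarrow> _. a)"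
    using assms by (simp add: fun_eq_iff pointwise_def clamp_id)
  ultimately show ?thesis by metis
qed

lemma definable_generator:
  assumes "k \<in> K"
  shows "(\<lambda>e. clamp (universe M) (e z k)) \<in> definable M K"
proof -
  have "pointwise M (Generator z k) [] \<in> definable M K"
    using assms by (intro definableI) (auto simp: operations_def)
  moreover have "pointwise M (Generator z k) [] = (\<lambda>e. clamp (universe M) (e z k))"
    by (simp add: fun_eq_iff pointwise_def)
  ultimately show ?thesis by metis
qed

lemma definable_fun:
  assumes M: "is_structure M" and f: "f \<in> funs (lang M)"
    and xs: "xs \<in> tuples (definable M K) (fun_arity (lang M) f)"
  shows "(\<lambda>e. fun_interp M f (map (\<lambda>x. x e) xs)) \<in> definable M K"
proof -
  have ne: "universe M \<noteq> {}" using M by (simp add: is_structure_def)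
  have "pointwise M (Function f) xs \<in> definable M K"
    using f xs by (intro definableI) (auto simp: operations_def tuples_def)
  moreover have "pointwise M (Function f) xs e = fun_interp M f (map (\<lambda>x. x e) xs)" for e
  proof -
    have "map (\<lambda>x. x e) xs \<in> tuples (universe M) (fun_arity (lang M) f)"
      using xs definable_universe[OF ne] by (auto simp: tuples_def)
    then show ?thesis
      using M f by (simp add: pointwise_def clamp_id is_structure_def)
  qed
  then have "pointwise M (Function f) xs = (\<lambda>e. fun_interp M f (map (\<lambda>x. x e) xs))" by (rule ext)
  ultimately show ?thesis by metis
qed

text \<open>The Skolem function is applied to the first \<open>m\<close> entries of
  \<open>s\<close>, where satisfaction of \<open>\<phi>\<close> depends only on the first
  \<open>m\<close> variables. The padding by \<open>undefined\<close> therefore has no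
  effect.\<close>

lemma definable_witness:
  fixes M :: "('a, 'f, 'r) struct" and K :: "'k set"
  assumes \<phi>: "wf_fm (lang M) \<phi>" and s: "range s \<subseteq> definable M K"
  shows "\<exists>x \<in> definable M K. \<forall>e. (\<exists>a \<in> universe M. sat M ((\<lambda>i. s i e)(n := a)) \<phi>) \<longrightarrow>
    sat M ((\<lambda>i. s i e)(n := x e)) \<phi>"
proof -
  obtain m where m: "depends_on {..<m::nat} (\<lambda>s. sat M s \<phi>)" using depends_on_sat by blast
  define x where "x = pointwise M (Witness n \<phi> :: ('a, 'k, 'f, 'r) operation) (map s [0..<m])"
  have "x \<in> definable M K"
    unfolding x_def using \<phi> s by (intro definableI) (auto simp: operations_def)
  moreover have "sat M ((\<lambda>i. s i e)(n := x e)) \<phi>"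
    if ex: "\<exists>a \<in> universe M. sat M ((\<lambda>i. s i e)(n := a)) \<phi>" for e
  proof -
    let ?as = "map (\<lambda>x. x e) (map s [0..<m])"
    have eq: "sat M ((\<lambda>i. if i < length ?as then ?as ! i else undefined)(n := a)) \<phi> =
        sat M ((\<lambda>i. s i e)(n := a)) \<phi>" for a
      by (rule depends_onD[OF m]) auto
    define a where "a = interp M (Witness n \<phi> :: ('a, 'k, 'f, 'r) operation) e ?as"
    have "a \<in> universe M \<and> sat M ((\<lambda>i. s i e)(n := a)) \<phi>"
      unfolding a_def interp.simps eq using someI_ex[OF ex[unfolded Bex_def]] .
    then show ?thesis unfolding x_def pointwise_def a_def[symmetric] by (simp add: clamp_id)
  qed
  ultimately show ?thesis by blast
qed

lemma definable_finite_support: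
  assumes "x \<in> definable M K"
  shows "\<exists>n. depends_on {- int n..<int n} x"
  using assms unfolding definable_def
proof induction
  case (step g xs)
  define S where "S n = {- int n..<int n}" for n
  have mono: "mono S" by (auto simp: mono_def S_def)
  obtain n where n: "depends_on (S n) (\<lambda>e. map (\<lambda>x. x e) xs)"
    using depends_on_list[OF mono, of xs "\<lambda>x. x"] step.IH unfolding S_def by auto
  \<comment> \<open>Only a generator reads a coordinate itself. The successor is needed because the
    interval is half-open: \<open>z = \<bar>z\<bar>\<close> must still lie below its upper
    end.\<close>
  define m where "m = (case g of Generator z k \<Rightarrow> Suc (nat \<bar>z\<bar>) | _ \<Rightarrow> 0)"
  have "pointwise M g xs e = pointwise M g xs e'" if "\<forall>i \<in> S (max m n). e i = e' i" for e e'
  proof -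
    have "map (\<lambda>x. x e) xs = map (\<lambda>x. x e') xs"
      using that monoD[OF mono, of n "max m n"] by (intro depends_onD[OF n]) auto
    moreover have "e z = e' z" if g: "g = Generator z k" for z k
    proof -
      have "z \<in> S (max m n)" by (auto simp: S_def m_def g)
      then show ?thesis using \<open>\<forall>i \<in> S (max m n). e i = e' i\<close> by blast
    qed
    ultimately show ?thesis unfolding pointwise_def by (cases g) (simp_all only: interp.simps)
  qed
  then show ?case unfolding depends_on_def S_def by blast
qed

text \<open>Translation only renames the integer of each generator, and generators are present for
  every integer.\<close>

lemma definable_shift:
  assumes "x \<in> definable M K"
  shows "(\<lambda>e. x (shift m e)) \<in> definable M K"
  using assms unfolding definable_def
proof induction
  case (step g xs)
  define g' where "g' = (case g of Generator z k \<Rightarrow> Generator (z + m) k | _ \<Rightarrow> g)"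
  have "g' \<in> operations M K"
    using step(1) by (cases g) (auto simp: operations_def g'_def image_iff)
  then have "pointwise M g' (map (\<lambda>x e. x (shift m e)) xs) \<in> closure (pointwise M) (operations M K)"
    using step(2) by (intro closure.step) auto
  moreover have "pointwise M g' (map (\<lambda>x e. x (shift m e)) xs) = (\<lambda>e. pointwise M g xs (shift m e))"
    by (rule ext, cases g) (simp_all add: pointwise_def g'_def comp_def shift_def)
  ultimately show ?case by metis
qed

lemma card_of_definable_bound:
  assumes r: "Cinfinite r" and "|universe M| \<le>o r" "|symbols (lang M)| \<le>o r" "|K| \<le>o r"
  shows "|definable M K| \<le>o r"
proof -
  have "|funs (lang M)| \<le>o r"
    using assms(3) unfolding symbols_def by (rule ordLeq_transitive[OF card_of_Plus1])
  then have "|operations M K| \<le>o r"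
    unfolding operations_def using assms
    by (intro Un_Cinfinite_bound card_of_image_bound[OF _ order_refl] card_of_Times_bound
        card_of_countable_bound card_of_wf_fm_bound)
  then show ?thesis unfolding definable_def by (rule card_of_closure_bound[OF r])
qed

section \<open>Placing the quotient in a sum type, and the final construction\<close>

lemma eventually_generator:
  assumes U: "ultrafilter U" and D: "ultrafilter D" "D \<le> iterated_filter U"
    and P: "\<forall>\<^sub>F j in U. P j"
  shows "\<forall>\<^sub>F e in D. P (e 0)"
proof -
  have "depends_on {0..<0 + int 1} (\<lambda>e. P (e 0))" by (simp add: depends_on_def)
  from ultrafilter_iterated[OF U D this] P show ?thesis by simp
qed

text \<open>An almost constant function goes to its constant in the left summand; any other goes to
  the code, under an injection of \<open>F\<close> into \<open>K\<close>, of a representative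
  depending only on its class.\<close>

lemma quotient_embedding:
  fixes D :: "'e filter" and F :: "('e \<Rightarrow> 'a) set" and K :: "'k set"
  assumes D: "ultrafilter D" and F: "|F| \<le>o |K|"
  obtains h :: "('e \<Rightarrow> 'a) \<Rightarrow> 'a + 'k" where
    "\<And>x y. x \<in> F \<Longrightarrow> y \<in> F \<Longrightarrow> h x = h y \<longleftrightarrow> (\<forall>\<^sub>F e in D. x e = y e)"
    "\<And>x a. (\<forall>\<^sub>F e in D. x e = a) \<Longrightarrow> h x = Inl a"
proof -
  obtain j :: "('e \<Rightarrow> 'a) \<Rightarrow> 'k" where j: "inj_on j F" using F card_of_ordLeq[of F K] by blast
  define canon where "canon x = (SOME y. y \<in> F \<and> (\<forall>\<^sub>F e in D. y e = x e))" for x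
  define h where "h x = (if \<exists>a. \<forall>\<^sub>F e in D. x e = a then Inl (SOME a. \<forall>\<^sub>F e in D. x e = a)
    else Inr (j (canon x)))" for x
  have unique: "a = b" if "\<forall>\<^sub>F e in D. x e = a" "\<forall>\<^sub>F e in D. x e = b" for x :: "'e \<Rightarrow> 'a" and a b
  proof -
    have "\<forall>\<^sub>F e in D. a = b" using that by (rule eventually_elim2) simp
    then show ?thesis by (simp add: ultrafilter_const[OF D])
  qed
  have h_Inl: "h x = Inl a" if "\<forall>\<^sub>F e in D. x e = a" for x a
  proof -
    have "(SOME a. \<forall>\<^sub>F e in D. x e = a) = a"
      by (rule some_equality[where P="\<lambda>a. \<forall>\<^sub>F e in D. x e = a", OF that unique[OF _ that]])
    moreover have "\<exists>a. \<forall>\<^sub>F e in D. x e = a" using that ..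
    ultimately show ?thesis by (simp add: h_def)
  qed
  have canon: "canon x \<in> F \<and> (\<forall>\<^sub>F e in D. canon x e = x e)" if "x \<in> F" for x
    unfolding canon_def by (rule someI[of _ x]) (simp add: that)
  have "h x = h y \<longleftrightarrow> (\<forall>\<^sub>F e in D. x e = y e)" if "x \<in> F" "y \<in> F" for x y
  proof
    assume eq: "h x = h y"
    show "\<forall>\<^sub>F e in D. x e = y e"
    proof (cases "\<exists>a. \<forall>\<^sub>F e in D. x e = a")
      case True
      then obtain a where a: "\<forall>\<^sub>F e in D. x e = a" ..
      then have "h y = Inl a" using eq h_Inl by simp
      then obtain b where b: "\<forall>\<^sub>F e in D. y e = b" by (auto simp: h_def split: if_splits)
      then have "a = b" using \<open>h y = Inl a\<close> h_Inl by simp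
      from a b show ?thesis by (rule eventually_elim2) (simp add: \<open>a = b\<close>)
    next
      case False
      then have "h x = Inr (j (canon x))" by (simp add: h_def)
      then have "j (canon x) = j (canon y)" using eq by (auto simp: h_def split: if_splits)
      then have "canon x = canon y" by (rule inj_onD[OF j]) (simp_all add: canon that)
      have "\<forall>\<^sub>F e in D. canon x e = x e" "\<forall>\<^sub>F e in D. canon y e = y e"
        by (simp_all add: canon that)
      from this[folded \<open>canon x = canon y\<close>] show ?thesis by (rule eventually_elim2) simp
    qed
  next
    \<comment> \<open>The predicates from which the two sides make their choices coincide, hence so
      do the chosen values.\<close>
    assume xy: "\<forall>\<^sub>F e in D. x e = y e"
    have "(\<forall>\<^sub>F e in D. x e = a) \<longleftrightarrow> (\<forall>\<^sub>F e in D. y e = a)" for a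
      by (rule eventually_cong[OF xy]) simp
    moreover have "(\<forall>\<^sub>F e in D. z e = x e) \<longleftrightarrow> (\<forall>\<^sub>F e in D. z e = y e)" for z
      by (rule eventually_cong[OF xy]) simp
    ultimately show "h x = h y" by (simp add: h_def canon_def)
  qed
  from that[OF this h_Inl] show ?thesis .
qed

lemma extension_of_cardinality:
  fixes M :: "('a, 'f, 'r) struct" and \<kappa> :: "'k rel"
  assumes M: "is_structure M" "infinite (universe M)"
    and \<kappa>: "Card_order \<kappa>" "|universe M| \<le>o \<kappa>" "|symbols (lang M)| \<le>o \<kappa>"
  shows "\<exists>(N :: ('a + 'k, 'f, 'r) struct) \<alpha>.
    proper_elementary_extension (copy Inl M) N \<and> |universe N| =o \<kappa> \<and> automorphism \<alpha> N \<and>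
    (\<forall>n\<ge>1. (\<forall>x \<in> universe (copy Inl M). (\<alpha> ^^ n) x = x) \<and>
            (\<forall>x \<in> universe N - universe (copy Inl M). (\<alpha> ^^ n) x \<noteq> x))"
proof -
  have ne: "universe M \<noteq> {}" using M by auto
  have Field: "|Field \<kappa>| =o \<kappa>" by (rule card_of_Field_ordIso[OF \<kappa>(1)])
  have "infinite (Field \<kappa>)"
    using card_of_ordLeq_infinite[OF _ M(2)]
      ordLeq_ordIso_trans[OF \<kappa>(2) ordIso_symmetric[OF Field]] by blast
  then have inf: "Cinfinite \<kappa>" using \<kappa>(1) by (simp add: cinfinite_def)
  obtain U :: "('k \<Rightarrow> 'a) filter" where U: "ultrafilter U"
    "\<And>k. \<forall>\<^sub>F j in U. j k \<in> universe M" "\<And>k a. \<forall>\<^sub>F j in U. j k \<noteq> a"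
    "\<And>k l. k \<noteq> l \<Longrightarrow> \<forall>\<^sub>F j in U. j k \<noteq> j l"
    using independent_ultrafilter[OF M(2)] by blast
  obtain D where D: "ultrafilter D" "D \<le> iterated_filter U"
    using ultrafilter_exists[OF iterated_filter_ne_bot[OF U(1)]] by blast
  define F where "F = definable M (Field \<kappa>)"
  have F_card: "|F| \<le>o \<kappa>"
    unfolding F_def
    by (rule card_of_definable_bound[OF inf \<kappa>(2,3) ordIso_imp_ordLeq[OF Field]])
  then have "|F| \<le>o |Field \<kappa>|" by (rule ordLeq_ordIso_trans[OF _ ordIso_symmetric[OF Field]])
  from quotient_embedding[OF D(1) this] obtain h :: "_ \<Rightarrow> 'a + 'k" where
    h_eq: "\<And>x y. x \<in> F \<Longrightarrow> y \<in> F \<Longrightarrow> h x = h y \<longleftrightarrow> (\<forall>\<^sub>F e in D. x e = y e)" and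
    h_Inl: "\<And>x a. (\<forall>\<^sub>F e in D. x e = a) \<Longrightarrow> h x = Inl a" by blast
  interpret definable_ultrapower M D F h Inl
    using M(1) D(1) h_eq h_Inl definable_universe[OF ne] definable_const definable_fun[OF M(1)]
      definable_witness unfolding F_def by unfold_locales auto

  \<comment> \<open>Finitely many members of \<open>F\<close> share a finite support, so translation
    invariance applies to any predicate of their values.\<close>
  have eventually_F_shift: "(\<forall>\<^sub>F e in D. Q (map (\<lambda>x. x (shift m e)) xs)) \<longleftrightarrow>
      (\<forall>\<^sub>F e in D. Q (map (\<lambda>x. x e) xs))" if "set xs \<subseteq> F" for Q m xs
  proof -
    have "\<exists>n. depends_on {- int n..<int n} (\<lambda>e. map (\<lambda>x. x e) xs)"
      using that unfolding F_def
      by (intro depends_on_list[of _ xs "\<lambda>x. x"] definable_finite_support[of _ M "Field \<kappa>"])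
        (auto simp: mono_def)
    then obtain n where "depends_on {- int n..<int n} (\<lambda>e. map (\<lambda>x. x e) xs)" ..
    then have "depends_on {- int n..<- int n + int (2 * n)} (\<lambda>e. Q (map (\<lambda>x. x e) xs))"
      using depends_on_compose[where g=Q] by simp
    from eventually_shift[OF U(1) D this] show ?thesis .
  qed
  have F_shift: "(\<lambda>e. x (shift m e)) \<in> F" if "x \<in> F" for x m
    using definable_shift that unfolding F_def .
  have h_shift: "h (\<lambda>e. x (shift m e)) = h (\<lambda>e. y (shift m e)) \<longleftrightarrow> h x = h y"
    if "x \<in> F" "y \<in> F" for x y m
    using eventually_F_shift[of "[x, y]" "\<lambda>vs. vs ! 0 = vs ! 1" m] that h_eq F_shift by simp

  \<comment> \<open>The choice of representative is harmless, since translation respects equality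
    almost everywhere on \<open>F\<close>.\<close>
  define \<alpha> where "\<alpha> y = h (\<lambda>e. rep y (shift 1 e))" for y
  have \<alpha>: "\<alpha> (h x) = h (\<lambda>e. x (shift 1 e))" if "x \<in> F" for x
    using h_shift[of "rep (h x)" x 1] that rep_in_F h_eq eventually_rep by (simp add: \<alpha>_def)
  have \<alpha>_pow: "(\<alpha> ^^ n) (h x) = h (\<lambda>e. x (shift (int n) e))" if "x \<in> F" for n x
  proof (induction n)
    case (Suc n)
    then show ?case using \<alpha>[OF F_shift[OF that]] by (simp add: shift_shift add.commute)
  qed simp
  have "automorphism \<alpha> power"
    unfolding automorphism_def isomorphism_def
  proof (intro conjI ballI refl)
    have "inj_on \<alpha> (h ` F)" by (rule inj_onI) (auto simp: \<alpha> h_shift)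
    \<comment> \<open>Translation by \<open>- 1\<close> supplies a preimage.\<close>
    moreover have "h x \<in> \<alpha> ` h ` F" if "x \<in> F" for x
      using \<alpha>[OF F_shift[OF that, of "- 1"]] F_shift[OF that, of "- 1"]
      by (auto simp: shift_shift intro!: rev_image_eqI)
    moreover have "\<alpha> (h x) \<in> h ` F" if "x \<in> F" for x using that by (simp add: \<alpha> F_shift)
    ultimately show "bij_betw \<alpha> (universe power) (universe power)"
      unfolding bij_betw_def universe_power by blast
  next
    fix f ys assume f: "f \<in> funs (lang power)"
      and "ys \<in> tuples (universe power) (fun_arity (lang power) f)"
    then obtain xs where xs: "xs \<in> tuples F (fun_arity (lang M) f)" "ys = map h xs"
      using tuples_power by auto
    let ?xs = "map (\<lambda>x e. x (shift 1 e)) xs"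
    have xs': "?xs \<in> tuples F (fun_arity (lang M) f)" using xs(1) F_shift by (auto simp: tuples_def)
    have "map \<alpha> ys = map h ?xs" using xs \<alpha> by (auto simp: tuples_def)
    then have "fun_interp power f (map \<alpha> ys) = h (\<lambda>e. fun_interp M f (map (\<lambda>x. x e) ?xs))"
      using fun_interp_power[OF _ xs'] f by simp
    moreover have "\<alpha> (fun_interp power f ys) = h (\<lambda>e. fun_interp M f (map (\<lambda>x. x (shift 1 e)) xs))"
      using fun_interp_power[OF _ xs(1)] \<alpha>[OF F_fun[OF _ xs(1)]] f xs(2) by simp
    ultimately show "\<alpha> (fun_interp power f ys) = fun_interp power f (map \<alpha> ys)"
      by (simp add: comp_def)
  next
    fix R ys assume "ys \<in> tuples (universe power) (rel_arity (lang power) R)"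
    then obtain xs where xs: "xs \<in> tuples F (rel_arity (lang M) R)" "ys = map h xs"
      using tuples_power by auto
    let ?xs = "map (\<lambda>x e. x (shift 1 e)) xs"
    have xs': "set xs \<subseteq> F" "set ?xs \<subseteq> F" using xs(1) F_shift by (auto simp: tuples_def)
    have "map \<alpha> ys = map h ?xs" using xs \<alpha> by (auto simp: tuples_def)
    then have "rel_interp power R (map \<alpha> ys) \<longleftrightarrow> (\<forall>\<^sub>F e in D. rel_interp M R (map (\<lambda>x. x e) ?xs))"
      using rel_interp_power[OF xs'(2)] by simp
    also have "\<dots> \<longleftrightarrow> rel_interp power R ys"
      using eventually_F_shift[OF xs'(1), of "rel_interp M R" 1] rel_interp_power[OF xs'(1)] xs(2)
      by (simp add: comp_def)
    finally show "rel_interp power R ys \<longleftrightarrow> rel_interp power R (map \<alpha> ys)" by simp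
  qed
  moreover have copy: "universe (copy Inl M) = (Inl ` universe M :: ('a + 'k) set)"
    by (simp add: copy_def)
  have "(\<alpha> ^^ n) y = y" if y: "y \<in> universe (copy Inl M)" for n y
  proof -
    obtain a where "a \<in> universe M" "y = h (\<lambda>_. a)" using y copy h_const by auto
    then show ?thesis using \<alpha>_pow[OF F_const] by simp
  qed
  moreover have "(\<alpha> ^^ n) y \<noteq> y"
    if "1 \<le> n" and y: "y \<in> universe power - universe (copy Inl M)" for n y
  proof
    assume fix_y: "(\<alpha> ^^ n) y = y"
    obtain x where x: "x \<in> F" "y = h x" using y by auto
    obtain p where p: "depends_on {- int p..<int p} x"
      using x(1) definable_finite_support unfolding F_def by blast
    \<comment> \<open>All multiples of \<open>n\<close> fix \<open>y\<close> as well; since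
      \<open>n \<ge> 1\<close>, the multiple \<open>n * (2 * p)\<close> translates far enough to
      clear the support of \<open>x\<close>.\<close>
    have "(\<alpha> ^^ (n * q)) y = y" for q
      by (induction q) (simp_all add: funpow_add fix_y)
    from this[of "2 * p"] have "h (\<lambda>e. x (shift (int (n * (2 * p))) e)) = h x"
      unfolding x(2) \<alpha>_pow[OF x(1)] .
    then have "\<forall>\<^sub>F e in D. x (shift (int (n * (2 * p))) e) = x e"
      using h_eq[OF F_shift[OF x(1)] x(1)] by blast
    moreover have "2 * p \<le> n * (2 * p)" using that(1) by simp
    ultimately obtain a where a: "\<forall>\<^sub>F e in D. x e = a"
      using shift_fixed_imp_constant[OF U(1) D p] by blast
    \<comment> \<open>The constant is a value actually taken by \<open>x\<close>, so it lies in the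
      universe and \<open>y\<close> is its copy, a contradiction.\<close>
    then obtain e where "x e = a" using eventually_happens' D(1) unfolding ultrafilter_def by blast
    then have "a \<in> universe M" using F_universe[OF x(1)] by blast
    then show False using h_Inl[OF a] x(2) y copy by blast
  qed
  moreover
  \<comment> \<open>The generators at the single coordinate \<open>0\<close> already give distinct
    classes outside the copy, one for each element of \<open>Field \<kappa>\<close>. This yields
    both the lower bound on the cardinality and properness.\<close>
  define gen where "gen k = (\<lambda>e :: int \<Rightarrow> 'k \<Rightarrow> 'a. clamp (universe M) (e 0 k))" for k
  have gen: "gen k \<in> F" if "k \<in> Field \<kappa>" for k
    using definable_generator[OF that] unfolding gen_def F_def .
  have gen_ev: "\<forall>\<^sub>F e in D. gen k e = e 0 k" for k
    using eventually_generator[OF U(1) D U(2)[of k]]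
    by (rule eventually_mono) (simp add: gen_def clamp_id)
  have gen_const: "h (gen k) \<notin> Inl ` universe M" if "k \<in> Field \<kappa>" for k
  proof
    assume "h (gen k) \<in> Inl ` universe M"
    then obtain a where "a \<in> universe M" "h (gen k) = h (\<lambda>_. a)" using h_const by auto
    then have "\<forall>\<^sub>F e in D. gen k e = a" using h_eq[OF gen[OF that] F_const] by simp
    with gen_ev[of k] have "\<forall>\<^sub>F e in D. e 0 k = a" by (rule eventually_elim2) simp
    moreover have "\<forall>\<^sub>F e in D. e 0 k \<noteq> a" by (rule eventually_generator[OF U(1) D U(3)])
    ultimately show False using ultrafilter_not[OF D(1)] by blast
  qed
  have "inj_on (\<lambda>k. h (gen k)) (Field \<kappa>)"
  proof (rule inj_onI, rule ccontr)
    fix k l assume kl: "k \<in> Field \<kappa>" "l \<in> Field \<kappa>" "h (gen k) = h (gen l)" "k \<noteq> l"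
    then have "\<forall>\<^sub>F e in D. gen k e = gen l e" using h_eq gen by blast
    with gen_ev[of k] have "\<forall>\<^sub>F e in D. gen l e = e 0 k" by (rule eventually_elim2) simp
    with gen_ev[of l] have "\<forall>\<^sub>F e in D. e 0 k = e 0 l" by (rule eventually_elim2) simp
    moreover have "\<forall>\<^sub>F e in D. e 0 k \<noteq> e 0 l" by (rule eventually_generator[OF U(1) D U(4)[OF kl(4)]])
    ultimately show False using ultrafilter_not[OF D(1)] by blast
  qed
  then have "|Field \<kappa>| \<le>o |h ` F|"
    using card_of_ordLeq[of "Field \<kappa>" "h ` F"] gen by blast
  then have "\<kappa> \<le>o |h ` F|" by (rule ordIso_ordLeq_trans[OF ordIso_symmetric[OF Field]])
  then have "|universe power| =o \<kappa>"
    using ordLeq_transitive[OF card_of_image F_card] by (simp add: ordIso_iff_ordLeq)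
  moreover
  obtain k where "k \<in> Field \<kappa>" using \<open>infinite (Field \<kappa>)\<close> by fastforce
  then have "h (gen k) \<in> universe power - universe (copy Inl M)"
    using gen gen_const by (simp add: copy)
  then have "proper_elementary_extension (copy Inl M) power"
    using elementary_extension_power
    by (auto simp: proper_elementary_extension_def elementary_extension_def substructure_def)
  ultimately show ?thesis by blast
qed

theorem theorem2p2:
  fixes M :: "('a, 'f, 'r) struct"
  assumes "is_structure M" and "infinite (universe M)"
  shows "(\<exists>(N :: ('a + ('a + 'f + 'r), 'f, 'r) struct) \<alpha>.
            proper_elementary_extension (copy Inl M) N \<and> automorphism \<alpha> N \<and>
            (\<forall>n\<ge>1. (\<forall>x \<in> universe (copy Inl M). (\<alpha> ^^ n) x = x) \<and>
                    (\<forall>x \<in> universe N - universe (copy Inl M). (\<alpha> ^^ n) x \<noteq> x)))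
       \<and> (\<forall>\<kappa> :: 'k rel. Card_order \<kappa> \<and> |universe M| \<le>o \<kappa> \<and> |symbols (lang M)| \<le>o \<kappa> \<longrightarrow>
           (\<exists>(N :: ('a + 'k, 'f, 'r) struct) \<alpha>.
              proper_elementary_extension (copy Inl M) N \<and> |universe N| =o \<kappa> \<and>
              automorphism \<alpha> N \<and>
              (\<forall>n\<ge>1. (\<forall>x \<in> universe (copy Inl M). (\<alpha> ^^ n) x = x) \<and>
                      (\<forall>x \<in> universe N - universe (copy Inl M). (\<alpha> ^^ n) x \<noteq> x))))"
proof (intro conjI allI impI)
  \<comment> \<open>Here \<open>\<kappa>\<close> is the cardinal of the disjoint union of the
    universe and the set of symbols, which bounds both.\<close>
  from extension_of_cardinality[OF assms card_of_Card_order card_of_Plus1 card_of_Plus2]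
  show "\<exists>(N :: ('a + ('a + 'f + 'r), 'f, 'r) struct) \<alpha>.
      proper_elementary_extension (copy Inl M) N \<and> automorphism \<alpha> N \<and>
      (\<forall>n\<ge>1. (\<forall>x \<in> universe (copy Inl M). (\<alpha> ^^ n) x = x) \<and>
              (\<forall>x \<in> universe N - universe (copy Inl M). (\<alpha> ^^ n) x \<noteq> x))"
    by blast
qed (use extension_of_cardinality[OF assms] in blast)

end
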